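(* Let $m,n$ be positive integers, let $\mathbf{w}\in[m]^n$ be a word, and let $\Delta\subset\mathbb{Z}$ be a bounded, co-bounded $m$-invariant set such that $\mathbf{w}\cdot\Delta=\Delta+n$. Then $\mathbf{w}$ is an $(m,n)$-parking function and $\Delta$ is $(m,n)$-invariant. Furthermore, for every $(m,n)$-parking function $\mathbf{w}$ there exists an $(m,n)$-invariant set $\Delta$ (bounded and co-bounded) such that $\mathbf{w}\cdot\Delta=\Delta+n$.
   Context: $[m]=\{0,1,\dots,m-1\}$. A set $\Delta\subset\mathbb{Z}$ is $k$-invariant if $\Delta+k\subset\Delta$; it is $(m,n)$-invariant if it is both $m$-invariant and $n$-invariant. It is bounded if it has a minimum element and co-bounded if $\mathbb{Z}_{\ge K}\subset\Delta$ for some $K$. For a bounded, co-bounded $m$-invariant set $\Delta$, its $m$-generators are the elements of $\Delta\setminus(\Delta+m)=\{a_0<a_1<\dots<a_{m-1}\}$ (one in each residue class mod $m$). A letter $j\in[m]$ acts by $j\cdot\Delta=\Delta\setminus\{a_j\}$ (again an $m$-invariant set). A word $\mathbf{w}=w_{n-1}w_{n-2}\dots w_0$ acts from right to left: $\mathbf{w}\cdot\Delta=w_{n-1}\cdot(\cdots(w_1\cdot(w_0\cdot\Delta))\cdots)$. An $(m,n)$-parking function is a word $\mathbf{w}=w_{n-1}\dots w_0\in[m]^n$ such that $\#\{j: w_j<i\}\ge \frac{in}{m}$ for all $1\le i\le m$. *)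

theory Defs
  imports Complex_Main
begin

definition shift :: "int set \<Rightarrow> nat \<Rightarrow> int set" where
  "shift \<Delta> k = (\<lambda>x. x + int k) ` \<Delta>"

definition invariant_set :: "nat \<Rightarrow> int set \<Rightarrow> bool" where
  "invariant_set k \<Delta> \<longleftrightarrow> shift \<Delta> k \<subseteq> \<Delta>"

definition biinvariant_set :: "nat \<Rightarrow> nat \<Rightarrow> int set \<Rightarrow> bool" where
  "biinvariant_set m n \<Delta> \<longleftrightarrow> invariant_set m \<Delta> \<and> invariant_set n \<Delta>"

(* In particular the empty set is not bounded in this sense. *)
definition bounded_set :: "int set \<Rightarrow> bool" where
  "bounded_set \<Delta> \<longleftrightarrow> (\<exists>a\<in>\<Delta>. \<forall>x\<in>\<Delta>. a \<le> x)"

definition cobounded_set :: "int set \<Rightarrow> bool" where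
  "cobounded_set \<Delta> \<longleftrightarrow> (\<exists>K. {K..} \<subseteq> \<Delta>)"

definition generators :: "nat \<Rightarrow> int set \<Rightarrow> int set" where
  "generators m \<Delta> = \<Delta> - shift \<Delta> m"

(* The generator a_j in increasing order, counted from 0. It is meaningful for j < m when \<Delta> is
   bounded, co-bounded and m-invariant with m > 0; then there are exactly m generators. *)
definition generator :: "nat \<Rightarrow> int set \<Rightarrow> nat \<Rightarrow> int" where
  "generator m \<Delta> j = sorted_list_of_set (generators m \<Delta>) ! j"

definition act_letter :: "nat \<Rightarrow> nat \<Rightarrow> int set \<Rightarrow> int set" where
  "act_letter m j \<Delta> = \<Delta> - {generator m \<Delta> j}"

(* Words are lists in the order in which they are written: w_{n-1} ... w_0 is the list
   [w_{n-1}, ..., w_0], so w_0 is the last entry. *)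
definition words :: "nat \<Rightarrow> nat \<Rightarrow> nat list set" where
  "words m n = {w. length w = n \<and> set w \<subseteq> {..<m}}"

definition letter :: "nat list \<Rightarrow> nat \<Rightarrow> nat" where
  "letter w j = w ! (length w - 1 - j)"

(* foldr applies the last entry w_0 first. *)
definition act_word :: "nat \<Rightarrow> nat list \<Rightarrow> int set \<Rightarrow> int set" where
  "act_word m w \<Delta> = foldr (act_letter m) w \<Delta>"

definition parking_function :: "nat \<Rightarrow> nat \<Rightarrow> nat list \<Rightarrow> bool" where
  "parking_function m n w \<longleftrightarrow> w \<in> words m n \<and>
     (\<forall>i\<in>{1..m}. real (card {j\<in>{..<n}. letter w j < i}) \<ge> real i * real n / real m)"

end

theory Submission
  imports Defs
begin

text \<open>
  Record \<open>\<Delta>\<close> by the increasing vector of its generators. A letter \<open>j\<close> adds \<open>m\<close> to the \<open>j\<close>-th entry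
  and re-sorts, and \<open>\<Delta>\<close> solves the equation iff its vector is fixed by
  \<open>F =\<close> (act by the word, then subtract \<open>n\<close>). The sum of the \<open>i\<close> smallest entries grows by at most
  \<open>m\<close> per letter below \<open>i\<close> and not at all for the other letters, but by \<open>i n\<close> in total; this is the
  parking condition.

  Conversely, \<open>F\<close> is monotone and preserves sums. For a parking function the orbit of \<open>0\<close> is
  bounded, hence eventually periodic, and the entrywise minimum \<open>y\<close> over a period satisfies
  \<open>F y \<le> y\<close>, hence \<open>F y = y\<close>. If two entries of \<open>y\<close> agree modulo \<open>m\<close>, scale everything by 2
  and perturb: raising a single entry of \<open>2 y\<close> by 1 is mapped by \<open>F\<close> to raising some other entry by 1,
  so \<open>F\<close> acts on entries, and it preserves the order of entries in the same residue class.
  Hence some cycle of this action meets such a class in a single entry, and raising \<open>2 y\<close> along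
  that cycle gives a fixed vector with more residues. When all residues are distinct, replacing each value \<open>v\<close> by the number
  of elements of \<open>\<Delta>\<close> (extended periodically) below it turns the scaled problem back into the
  original one.
\<close>

section \<open>Sorted vectors and the monotone action of letters on them\<close>

text \<open>Vectors of length \<open>m\<close> are functions on \<open>nat\<close>; entries from \<open>m\<close> on are ignored.\<close>

definition sorted_upto :: "nat \<Rightarrow> (nat \<Rightarrow> int) \<Rightarrow> bool" where
  "sorted_upto m x \<longleftrightarrow> (\<forall>i. Suc i < m \<longrightarrow> x i \<le> x (Suc i))"

text \<open>For sorted \<open>x\<close> this is \<open>x\<close> with \<open>J\<close> added to entry \<open>j\<close>, sorted again. The min-max form makes
  monotonicity evident.\<close>

definition bump :: "nat \<Rightarrow> int \<Rightarrow> nat \<Rightarrow> (nat \<Rightarrow> int) \<Rightarrow> nat \<Rightarrow> int" where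
  "bump m J j x i =
     (if i < j \<or> m \<le> i then x i
      else if Suc i < m then max (x i) (min (x (Suc i)) (x j + J))
      else max (x i) (x j + J))"

abbreviation run :: "nat \<Rightarrow> int \<Rightarrow> nat list \<Rightarrow> (nat \<Rightarrow> int) \<Rightarrow> nat \<Rightarrow> int" where
  "run m J w x \<equiv> foldr (bump m J) w x"

lemma sorted_uptoD:
  assumes "sorted_upto m x" "i \<le> k" "k < m"
  shows "x i \<le> x k"
  using assms(2,3)
proof (induction k rule: dec_induct)
  case (step k)
  then show ?case
    using assms(1) unfolding sorted_upto_def by (meson Suc_lessD order_trans)
qed simp

lemma sorted_upto_bump:
  assumes "sorted_upto m x"
  shows "sorted_upto m (bump m J j x)"
  unfolding sorted_upto_def
proof (intro allI impI)
  fix i assume i: "Suc i < m"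
  then have "x i \<le> x (Suc i)" using assms by (simp add: sorted_upto_def)
  then show "bump m J j x i \<le> bump m J j x (Suc i)"
    using i by (auto simp: bump_def)
qed

lemma sorted_upto_run: "sorted_upto m x \<Longrightarrow> sorted_upto m (run m J w x)"
  by (induction w) (auto intro: sorted_upto_bump)

lemma bump_ge: "x i \<le> bump m J j x i"
  by (simp add: bump_def)

lemma run_ge: "x i \<le> run m J w x i"
  by (induction w) (auto intro: order_trans bump_ge)

lemma bump_le:
  assumes "sorted_upto m x" "0 \<le> J" "j < m"
  shows "bump m J j x i \<le> x i + J"
  using assms sorted_uptoD[OF assms(1), of j i] by (auto simp: bump_def)

lemma run_le:
  assumes "sorted_upto m x" "0 \<le> J" "set w \<subseteq> {..<m}"
  shows "run m J w x i \<le> x i + J * int (length w)"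
  using assms(3)
proof (induction w)
  case (Cons a w)
  have "bump m J a (run m J w x) i \<le> run m J w x i + J"
    using Cons.prems assms by (intro bump_le sorted_upto_run) auto
  with Cons show ?case by (simp add: algebra_simps)
qed simp

lemma bump_mono:
  assumes "\<And>i. i < m \<Longrightarrow> x i \<le> y i" "j < m" "i < m"
  shows "bump m J j x i \<le> bump m J j y i"
  using assms(1)[of i] assms(1)[of j] assms(1)[of "Suc i"] assms(2,3)
  by (auto simp: bump_def max_def min_def)

lemma run_mono:
  assumes "\<And>i. i < m \<Longrightarrow> x i \<le> y i" "set w \<subseteq> {..<m}" "i < m"
  shows "run m J w x i \<le> run m J w y i"
  using assms(2,3)
  by (induction w arbitrary: i) (auto intro!: bump_mono assms(1))

text \<open>\<open>bump\<close> is built from maxima, minima and translation by \<open>J\<close>,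
  all of which \<open>f\<close> respects. Later uses are doubling, \<open>2 * v + 1\<close>, and a
  counting function that brings the step back to \<open>m\<close>.\<close>

lemma bump_comp:
  assumes "mono f" "\<And>v. f (v + J) = f v + K"
  shows "bump m K j (\<lambda>i. f (x i)) = (\<lambda>i. f (bump m J j x i))"
  using assms by (auto simp: bump_def fun_eq_iff max_of_mono min_of_mono
      simp flip: assms(2))

lemma run_comp:
  assumes "mono f" "\<And>v. f (v + J) = f v + K"
  shows "run m K w (\<lambda>i. f (x i)) = (\<lambda>i. f (run m J w x i))"
  by (induction w) (simp_all add: bump_comp[OF assms])

lemma run_double: "run m (2 * J) w (\<lambda>i. 2 * x i) = (\<lambda>i. 2 * run m J w x i)"
  by (rule run_comp) (auto simp: mono_def)

section \<open>Sums over all entries and over initial segments\<close>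

text \<open>With \<open>h\<close> arbitrary, this says that \<open>bump\<close> only replaces \<open>x j\<close> by \<open>x j + J\<close> in the multiset
  of entries.\<close>

lemma sum_bump_prefix:
  fixes h :: "int \<Rightarrow> 'a :: comm_monoid_add"
  assumes "sorted_upto m x" "0 \<le> J" "j < i" "i \<le> m"
  shows "(\<Sum>l<i. h (bump m J j x l)) + h (x j) =
         (\<Sum>l<i. h (x l)) + h (if i < m then min (x i) (x j + J) else x j + J)"
  using assms(3,4)
proof (induction i)
  case (Suc i)
  define c where "c = x j + J"
  have low: "(\<Sum>l<j. h (bump m J j x l)) = (\<Sum>l<j. h (x l))"
    by (rule sum.cong) (auto simp: bump_def)
  show ?case
  proof (cases "j = i")
    case True
    have "Suc i < m \<Longrightarrow> x i \<le> x (Suc i)"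
      using assms(1) by (simp add: sorted_upto_def)
    then have "bump m J j x i = (if Suc i < m then min (x (Suc i)) (x j + J) else x j + J)"
      using True Suc.prems assms(2) by (auto simp: bump_def)
    then show ?thesis using low True by (simp add: ac_simps)
  next
    case False
    have "x i \<le> x (Suc i)" if "Suc i < m"
      using assms(1) that by (simp add: sorted_upto_def)
    moreover have "bump m J j x i = (if Suc i < m then max (x i) (min (x (Suc i)) c) else max (x i) c)"
      using False Suc.prems by (simp add: bump_def c_def)
    \<comment> \<open>Since \<open>x i \<le> x (Suc i)\<close>, the two arguments of
      \<open>h\<close> on the left are those on the right in some order. This moves the displaced
      value from \<open>min (x i) c\<close> on to \<open>min (x (Suc i)) c\<close>.\<close>
    ultimately have key: "h (bump m J j x i) + h (min (x i) c) =
        h (x i) + h (if Suc i < m then min (x (Suc i)) c else c)"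
      by (cases "c \<le> x i") (auto simp: max_def min_def add.commute)
    have IH: "(\<Sum>l<i. h (bump m J j x l)) + h (x j) = (\<Sum>l<i. h (x l)) + h (min (x i) c)"
      using Suc False by (simp add: c_def)
    have "(\<Sum>l<Suc i. h (bump m J j x l)) + h (x j)
        = ((\<Sum>l<i. h (bump m J j x l)) + h (x j)) + h (bump m J j x i)"
      by (simp add: ac_simps)
    also have "\<dots> = (\<Sum>l<i. h (x l)) + (h (bump m J j x i) + h (min (x i) c))"
      unfolding IH by (simp add: ac_simps)
    also have "\<dots> = (\<Sum>l<Suc i. h (x l)) + h (if Suc i < m then min (x (Suc i)) c else c)"
      unfolding key by (simp add: ac_simps)
    finally show ?thesis unfolding c_def .
  qed
qed simp

lemma sum_bump:
  fixes h :: "int \<Rightarrow> 'a :: comm_monoid_add"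
  assumes "sorted_upto m x" "0 \<le> J" "j < m"
  shows "(\<Sum>l<m. h (bump m J j x l)) + h (x j) = (\<Sum>l<m. h (x l)) + h (x j + J)"
  using sum_bump_prefix[OF assms order.refl, of h] by simp

text \<open>Each letter trades one entry \<open>v\<close> for \<open>v + J\<close>, which costs
  exactly \<open>c\<close>. Besides the identity, \<open>h\<close> will be a rounded quotient with
  \<open>c = - 1\<close>.\<close>

lemma sum_run_step:
  fixes h :: "int \<Rightarrow> int"
  assumes "sorted_upto m x" "0 \<le> J" "set w \<subseteq> {..<m}" "\<And>v. h (v + J) = h v + c"
  shows "(\<Sum>l<m. h (run m J w x l)) = (\<Sum>l<m. h (x l)) + c * int (length w)"
  using assms(3)
proof (induction w)
  case (Cons a w)
  have "(\<Sum>l<m. h (bump m J a (run m J w x) l)) = (\<Sum>l<m. h (run m J w x l)) + c"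
    using sum_bump[OF sorted_upto_run[OF assms(1)] assms(2), of a h J w] Cons.prems
    by (simp add: assms(4))
  with Cons show ?case by (simp add: algebra_simps)
qed simp

text \<open>For \<open>j < i < m\<close> the prefix loses \<open>x j\<close> and receives either
  \<open>x j + J\<close> or, if that overtakes position \<open>i\<close>, the entry
  \<open>x i\<close>.\<close>

lemma prefix_bump:
  assumes "sorted_upto m x" "0 \<le> J" "j < m" "i \<le> m"
  shows "(\<Sum>l<i. bump m J j x l) =
    (\<Sum>l<i. x l) + (if i \<le> j then 0 else if i < m then min J (x i - x j) else J)"
proof (cases "i \<le> j")
  case True
  then show ?thesis by (auto simp: bump_def intro!: sum.cong)
next
  case False
  then show ?thesis
    using sum_bump_prefix[OF assms(1,2), of j i "\<lambda>v. v"] assms(4)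
    by (auto simp: min_def split: if_splits)
qed

text \<open>By \<open>prefix_bump\<close>, only letters below \<open>i\<close> contribute, each at
  most \<open>J\<close>. With \<open>J = m\<close> this yields the necessity of the parking
  condition.\<close>

lemma prefix_run_le:
  assumes "sorted_upto m x" "0 \<le> J" "set w \<subseteq> {..<m}" "i \<le> m"
  shows "(\<Sum>l<i. run m J w x l) \<le> (\<Sum>l<i. x l) + J * int (length (filter (\<lambda>a. a < i) w))"
  using assms(3)
proof (induction w)
  case (Cons a w)
  have "(\<Sum>l<i. bump m J a (run m J w x) l) \<le>
      (\<Sum>l<i. run m J w x l) + (if a < i then J else 0)"
    using prefix_bump[OF sorted_upto_run[OF assms(1)] assms(2), of a i J w] Cons.prems assms(4)
    by auto
  with Cons show ?case by (auto simp: algebra_simps)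
qed simp

text \<open>Entries rise by at most \<open>J\<close> per letter, so the gap below position
  \<open>i\<close> is still at least \<open>J\<close> whenever a letter acts. Nothing crosses it,
  and \<open>prefix_run_le\<close> is attained.\<close>

lemma prefix_run_eq:
  assumes "sorted_upto m x" "0 \<le> J" "set w \<subseteq> {..<m}" "0 < i" "i < m"
    and "J * int (length w) \<le> x i - x (i - 1)"
  shows "(\<Sum>l<i. run m J w x l) = (\<Sum>l<i. x l) + J * int (length (filter (\<lambda>a. a < i) w))"
  using assms(3,6)
proof (induction w)
  case (Cons a w)
  let ?y = "run m J w x"
  have gap: "J \<le> ?y i - ?y (i - 1)"
    using run_le[OF assms(1,2), of w "i - 1"] run_ge[of x i m J w] Cons.prems
    by (simp add: algebra_simps)
  have "J \<le> ?y i - ?y a" if "a < i"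
  proof -
    have "?y a \<le> ?y (i - 1)"
      using that assms(5) by (intro sorted_uptoD[OF sorted_upto_run[OF assms(1)]]) auto
    with gap show ?thesis by linarith
  qed
  then have "(\<Sum>l<i. bump m J a ?y l) = (\<Sum>l<i. ?y l) + (if a < i then J else 0)"
    using prefix_bump[OF sorted_upto_run[OF assms(1)] assms(2), of a i J w] Cons.prems assms(5)
    by auto
  moreover have "J * int (length w) \<le> x i - x (i - 1)"
    using Cons.prems assms(2) by (simp add: algebra_simps)
  ultimately show ?case using Cons by (auto simp: algebra_simps)
qed simp

section \<open>A fixed vector from a bounded orbit\<close>

text \<open>The parking condition serves to keep the orbit of \<open>0\<close> inside the finite set
  \<open>R\<close>.\<close>

lemma ex_fixed_vector:
  assumes "0 < m" and w: "set w \<subseteq> {..<m}"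
    and parking: "\<And>i. i \<le> m \<Longrightarrow> i * length w \<le> m * length (filter (\<lambda>a. a < i) w)"
  obtains y where "sorted_upto m y" "\<And>i. i < m \<Longrightarrow> run m (int m) w y i = y i + int (length w)"
proof -
  define n where "n = length w"
  define F where "F x = (\<lambda>i. if i < m then run m (int m) w x i - int n else x i)" for x
  define K :: int where "K = 2 * int m * int n"
  define Q where "Q i = K * int i * (int i - int m)" for i
  \<comment> \<open>\<open>R\<close> is invariant under \<open>F\<close>: a prefix sum drops, by at most \<open>m n\<close>, only where the second difference
     of the prefix sums is below \<open>m n\<close>, while that of \<open>Q\<close> is \<open>2 K = 4 m n\<close>.\<close>
  define R where "R = {x. sorted_upto m x \<and> (\<Sum>l<m. x l) = 0 \<and>
      (\<forall>i\<le>m. Q i \<le> (\<Sum>l<i. x l)) \<and> (\<forall>i\<ge>m. x i = 0)}"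
  have F_sum: "(\<Sum>l<i. F x l) = (\<Sum>l<i. run m (int m) w x l) - int i * int n" if "i \<le> m" for x i
  proof -
    have "(\<Sum>l<i. F x l) = (\<Sum>l<i. run m (int m) w x l - int n)"
      using that by (intro sum.cong) (auto simp: F_def)
    then show ?thesis by (simp add: sum_subtractf)
  qed
  have F_total: "(\<Sum>l<m. F x l) = (\<Sum>l<m. x l)" if "sorted_upto m x" for x
    using F_sum[of m x] sum_run_step[where h = "\<lambda>v. v" and c = "int m", OF that _ w] by (simp add: n_def)
  have F_sorted: "sorted_upto m (F x)" if "sorted_upto m x" for x
    using sorted_upto_run[where J = "int m" and w = w, OF that] by (simp add: sorted_upto_def F_def)
  have F_mono: "F x i \<le> F y i" if "\<And>i. i < m \<Longrightarrow> x i \<le> y i" "i < m" for x y i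
    using run_mono[where J = "int m", OF that(1) w that(2)] that(2) by (simp add: F_def)
  have F_R: "F x \<in> R" if "x \<in> R" for x
  proof -
    have x: "sorted_upto m x" "(\<Sum>l<m. x l) = 0" "\<And>i. i \<le> m \<Longrightarrow> Q i \<le> (\<Sum>l<i. x l)"
      "\<And>i. i \<ge> m \<Longrightarrow> x i = 0"
      using that by (auto simp: R_def)
    have "Q i \<le> (\<Sum>l<i. F x l)" if im: "i \<le> m" for i
    proof -
      consider "i = 0" | "i = m" | "0 < i" "i < m"
        using im by (metis gr0I le_neq_implies_less)
      then show ?thesis
      proof cases
        case 3
        show ?thesis
        proof (cases "int m * int n \<le> x i - x (i - 1)")
          case True
          have "int (i * length w) \<le> int (m * length (filter (\<lambda>a. a < i) w))"
            using parking[OF im] by (simp only: of_nat_le_iff)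
          then have "int i * int n \<le> int m * int (length (filter (\<lambda>a. a < i) w))"
            by (simp add: n_def)
          then show ?thesis
            using prefix_run_eq[where J = "int m", OF x(1) _ w 3] True F_sum[OF im, of x] x(3)[OF im]
            by (simp add: n_def)
        next
          case False
          \<comment> \<open>Averaging the bounds at \<open>k\<close> and \<open>Suc i\<close> puts
            the prefix sum at \<open>i\<close> above \<open>Q i\<close> by more than
            \<open>m * n\<close>, or exactly at least at \<open>Q i\<close> when
            \<open>n = 0\<close>, so it survives a loss of \<open>i * n\<close>.\<close>
          define k where "k = i - 1"
          have k: "i = Suc k" using 3 by (simp add: k_def)
          have "(\<Sum>l<i. x l) \<le> (\<Sum>l<i. run m (int m) w x l)"
            by (intro sum_mono run_ge)
          then have 1: "(\<Sum>l<i. x l) - int i * int n \<le> (\<Sum>l<i. F x l)"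
            using F_sum[OF im, of x] by simp
          have "int i * int n \<le> int m * int n" using im by (intro mult_right_mono) auto
          moreover have "Q (Suc i) \<le> (\<Sum>l<Suc i. x l)" "Q k \<le> (\<Sum>l<k. x l)"
            using 3 k by (intro x(3); simp)+
          moreover have "x i - x k < int m * int n" using False by (simp add: k_def)
          moreover have "Q (Suc i) + Q k = 2 * Q i + 2 * K"
            unfolding Q_def k by (simp add: algebra_simps)
          moreover have "K = 2 * (int m * int n)" by (simp add: K_def)
          moreover have "0 \<le> int m * int n" by simp
          moreover have "(\<Sum>l<Suc i. x l) = (\<Sum>l<i. x l) + x i" by simp
          moreover have "(\<Sum>l<i. x l) = (\<Sum>l<k. x l) + x k" by (simp add: k)
          ultimately show ?thesis using 1 by linarith
        qed
      qed (use F_total[OF x(1)] x(2) in \<open>simp_all add: Q_def\<close>)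
    qed
    then show ?thesis
      using F_total[OF x(1)] F_sorted[OF x(1)] x by (auto simp: R_def F_def)
  qed
  have "finite R"
  proof (rule finite_subset)
    have K0: "0 \<le> K" by (simp add: K_def)
    show "R \<subseteq> {x. \<forall>i. (i \<in> {..<m} \<longrightarrow> x i \<in> {- (K * int m)..K * int m}) \<and>
        (i \<notin> {..<m} \<longrightarrow> x i = 0)}"
    proof (clarsimp simp: R_def)
      fix x i assume x: "sorted_upto m x" "(\<Sum>l<m. x l) = 0" "\<forall>i\<le>m. Q i \<le> (\<Sum>l<i. x l)" and i: "i < m"
      have m: "m = Suc (m - 1)" using assms(1) by simp
      \<comment> \<open>\<open>Q 1\<close> bounds the smallest entry from below;
        \<open>Q (m - 1)\<close> together with total 0 bounds the largest from above.\<close>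
      have "Q 1 \<le> x 0" using x(3)[rule_format, of 1] assms(1) by simp
      moreover have "x 0 \<le> x i" "x i \<le> x (m - 1)" using sorted_uptoD[OF x(1)] i by auto
      moreover have "Q (m - 1) \<le> (\<Sum>l<m - 1. x l)" using x(3) by simp
      moreover have "(\<Sum>l<m - 1. x l) + x (m - 1) = 0"
        using x(2) sum.lessThan_Suc[of x "m - 1"] m by simp
      moreover have "Q 1 = K - K * int m" by (simp add: Q_def algebra_simps)
      moreover have "Q (m - 1) = K - K * int m"
        using assms(1) by (simp add: Q_def of_nat_diff algebra_simps)
      ultimately show "- (K * int m) \<le> x i \<and> x i \<le> K * int m" using K0 by linarith
    qed
  qed (intro finite_set_of_finite_funs; simp)
  have Fk_R: "(F ^^ k) (\<lambda>_. 0) \<in> R" for k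
  proof (induction k)
    case 0
    have "Q i \<le> 0" if "i \<le> m" for i
      unfolding Q_def using that by (intro mult_nonneg_nonpos) (auto simp: K_def)
    then show ?case by (auto simp: R_def sorted_upto_def)
  qed (use F_R in simp)
  have "finite (range (\<lambda>k. (F ^^ k) (\<lambda>_. 0)))"
    using \<open>finite R\<close> Fk_R by (auto intro: finite_subset)
  then have "\<not> inj (\<lambda>k. (F ^^ k) (\<lambda>_. 0))"
    using finite_imageD by blast
  then obtain a b where ab: "a < b" "(F ^^ a) (\<lambda>_. 0) = (F ^^ b) (\<lambda>_. 0)"
    unfolding inj_def by (metis linorder_neqE_nat)
  define X where "X k = (F ^^ k) (\<lambda>_. 0)" for k
  have X: "sorted_upto m (X k)" for k using Fk_R[of k] by (simp add: R_def X_def)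
  define y where "y i = Min ((\<lambda>k. X k i) ` {a..<b})" for i
  have y_le: "y i \<le> X k i" if "k \<in> {a..b}" for k i
  proof (cases "k = b")
    case True
    have "y i \<le> X a i" unfolding y_def using ab(1) by (intro Min_le) auto
    then show ?thesis using True ab(2) by (simp add: X_def)
  qed (use that in \<open>auto simp: y_def intro!: Min_le\<close>)
  have y_ex: "\<exists>k\<in>{a..<b}. y i = X k i" for i
  proof -
    have "y i \<in> (\<lambda>k. X k i) ` {a..<b}" unfolding y_def using ab by (intro Min_in) auto
    then show ?thesis by auto
  qed
  have y_sorted: "sorted_upto m y"
    unfolding sorted_upto_def
  proof (intro allI impI)
    fix i assume "Suc i < m"
    obtain k where k: "k \<in> {a..<b}" "y (Suc i) = X k (Suc i)" using y_ex by blast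
    have "y i \<le> X k i" using k by (intro y_le) auto
    also have "\<dots> \<le> X k (Suc i)" using X[of k] \<open>Suc i < m\<close> by (simp add: sorted_upto_def)
    finally show "y i \<le> y (Suc i)" using k by simp
  qed
  have F_y_le: "F y i \<le> y i" if i: "i < m" for i
  proof -
    \<comment> \<open>every vector of the period is \<open>F\<close> of one in the period, so the minimum is attained at a successor\<close>
    obtain k where k: "k \<in> {a..<b}" "y i = X (Suc k) i"
    proof -
      obtain k where k: "k \<in> {a..<b}" "y i = X k i" using y_ex by blast
      show ?thesis
      proof (cases "k = a")
        case True
        then have "y i = X (Suc (b - 1)) i" "b - 1 \<in> {a..<b}" using k ab by (auto simp: X_def)
        then show ?thesis using that by blast
      next
        case False
        then have "k - 1 \<in> {a..<b}" "Suc (k - 1) = k" using k(1) by auto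
        then show ?thesis using k(2) that[of "k - 1"] by simp
      qed
    qed
    have "F y i \<le> F (X k) i" using k by (intro F_mono y_le i) auto
    then show ?thesis using k by (simp add: X_def)
  qed
  have "F y i = y i" if "i < m" for i
    by (rule sum_mono_inv[of "F y" "{..<m}" y]) (use that F_y_le F_total[OF y_sorted] in auto)
  then have "run m (int m) w y i = y i + int (length w)" if "i < m" for i
    using that by (force simp: F_def n_def)
  then show ?thesis using y_sorted that by blast
qed

section \<open>Infinitesimal perturbations\<close>

text \<open>Doubling the scale makes room for odd values: relative to \<open>x\<close>, the entries
  in \<open>A\<close> rise by one half, less than any gap between distinct entries.\<close>

definition raise :: "(nat \<Rightarrow> int) \<Rightarrow> nat set \<Rightarrow> nat \<Rightarrow> int" where
  "raise x A i = 2 * x i + of_bool (i \<in> A)"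

text \<open>The positions at which an entry can be raised by an infinitesimal amount without
  breaking the order.\<close>

definition is_top :: "nat \<Rightarrow> (nat \<Rightarrow> int) \<Rightarrow> nat \<Rightarrow> bool" where
  "is_top m x a \<longleftrightarrow> a < m \<and> (Suc a < m \<longrightarrow> x a < x (Suc a))"

lemma raise_mod: "0 \<le> J \<Longrightarrow> raise x A i mod (2 * J) = 2 * (x i mod J) + of_bool (i \<in> A)"
  using pos_zmod_mult_2[of J "x i"] mult_mod_right[of 2 "x i" J]
  by (cases "i \<in> A") (simp_all only: raise_def of_bool_eq add.commute[of "2 * _" 1] add_0_right)

lemma sorted_raise:
  assumes "sorted_upto m x" "\<And>a. a \<in> A \<Longrightarrow> is_top m x a"
  shows "sorted_upto m (raise x A)"
  unfolding sorted_upto_def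
proof (intro allI impI)
  fix i assume i: "Suc i < m"
  then have "x i \<le> x (Suc i)" using assms(1) by (simp add: sorted_upto_def)
  moreover have "i \<in> A \<Longrightarrow> x i < x (Suc i)" using assms(2)[of i] i by (simp add: is_top_def)
  ultimately show "raise x A i \<le> raise x A (Suc i)" by (auto simp: raise_def)
qed

lemma sum_raise:
  assumes "a < m"
  shows "(\<Sum>l<m. raise x {a} l) = 2 * (\<Sum>l<m. x l) + 1"
proof -
  have "{..<m} \<inter> {a} = {a}" using assms by auto
  then show ?thesis
    using assms by (simp add: raise_def sum.distrib sum_distrib_left of_bool_def sum.If_cases)
qed

text \<open>Monotonicity squeezes the result between \<open>2 * X\<close> and
  \<open>2 * X + 1\<close>, and the sums leave exactly one entry raised. Its residue is the only odd
  one modulo \<open>2 * J\<close>, which identifies its class.\<close>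

lemma bump_raise_ex:
  assumes x: "sorted_upto m x" and "is_top m x a" "j < m" "0 \<le> J"
  shows "\<exists>b. bump m (2 * J) j (raise x {a}) = raise (bump m J j x) {b} \<and>
    is_top m (bump m J j x) b \<and> bump m J j x b mod J = x a mod J"
proof -
  define X where "X = bump m J j x"
  define Z where "Z = bump m (2 * J) j (raise x {a})"
  have a: "a < m" using assms by (simp add: is_top_def)
  have srt: "sorted_upto m (raise x {a})" using assms by (intro sorted_raise) auto
  then have Z: "sorted_upto m Z" unfolding Z_def by (rule sorted_upto_bump)
  have dbl: "bump m (2 * J) j (\<lambda>i. 2 * x i) = (\<lambda>i. 2 * X i)"
    unfolding X_def by (rule bump_comp) (auto simp: mono_def)
  have dbl1: "bump m (2 * J) j (\<lambda>i. 2 * x i + 1) = (\<lambda>i. 2 * X i + 1)"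
    unfolding X_def by (rule bump_comp[where f = "\<lambda>v. 2 * v + 1"]) (auto simp: mono_def)
  have lo: "2 * X i \<le> Z i" if "i < m" for i
    unfolding Z_def fun_cong[OF dbl, symmetric]
    by (rule bump_mono) (use assms that in \<open>auto simp: raise_def\<close>)
  have hi: "Z i \<le> 2 * X i + 1" if "i < m" for i
    unfolding Z_def fun_cong[OF dbl1, symmetric]
    by (rule bump_mono) (use assms that in \<open>auto simp: raise_def\<close>)
  have "(\<Sum>l<m. Z l) = (\<Sum>l<m. raise x {a} l) + 2 * J"
    using sum_bump[of m "raise x {a}" "2 * J" j "\<lambda>v. v"] srt assms by (simp add: Z_def)
  moreover have "(\<Sum>l<m. X l) = (\<Sum>l<m. x l) + J"
    using sum_bump[of m x J j "\<lambda>v. v"] assms by (simp add: X_def)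
  ultimately have total: "(\<Sum>l<m. Z l - 2 * X l) = 1"
    by (simp add: sum_raise[OF a] sum_subtractf flip: sum_distrib_left)
  then obtain b where b: "b < m" "Z b - 2 * X b \<noteq> 0"
    by (metis (no_types, lifting) lessThan_iff sum.neutral zero_neq_one)
  then have Zb: "Z b = 2 * X b + 1" using lo[of b] hi[of b] by simp
  have "(\<Sum>l<m. Z l - 2 * X l) = (Z b - 2 * X b) + (\<Sum>l\<in>{..<m} - {b}. Z l - 2 * X l)"
    using b by (intro sum.remove) auto
  then have rest: "(\<Sum>l\<in>{..<m} - {b}. Z l - 2 * X l) = 0" using total Zb by simp
  have "\<forall>l\<in>{..<m} - {b}. Z l - 2 * X l = 0"
    using sum_nonneg_eq_0_iff[of "{..<m} - {b}" "\<lambda>l. Z l - 2 * X l"] rest lo by auto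
  then have "Z i = raise X {b} i" for i
    using Zb a b by (cases "i < m"; cases "i = b") (auto simp: raise_def Z_def X_def bump_def)
  then have Zeq: "Z = raise X {b}" by blast
  have "is_top m X b"
    using Z b Zb \<open>\<And>i. Z i = raise X {b} i\<close>[of "Suc b"]
    by (auto simp: is_top_def sorted_upto_def raise_def dest!: spec[of _ b])
  moreover have "X b mod J = x a mod J"
  proof -
    \<comment> \<open>\<open>h\<close> marks the residue of the raised entry; adding
      \<open>2 * J\<close> to an entry does not change how many entries are marked.\<close>
    define h :: "int \<Rightarrow> nat" where "h v = of_bool (v mod (2 * J) = raise x {a} a mod (2 * J))" for v
    have "(\<Sum>l<m. h (Z l)) = (\<Sum>l<m. h (raise x {a} l))"
      using sum_bump[of m "raise x {a}" "2 * J" j h] srt assms by (simp add: Z_def h_def)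
    also have "\<dots> \<noteq> 0" using a by (auto simp: h_def)
    finally obtain i where "i < m" "h (Z i) \<noteq> 0" by (metis lessThan_iff sum.neutral)
    then have "raise X {b} i mod (2 * J) = raise x {a} a mod (2 * J)"
      by (simp add: h_def Zeq split: if_splits)
    then have *: "2 * (X i mod J) + of_bool (i = b) = 2 * (x a mod J) + 1"
      using assms by (simp add: raise_mod)
    have "i = b"
    proof (rule ccontr)
      assume "i \<noteq> b"
      with * have "2 * (X i mod J) = 2 * (x a mod J) + 1" by simp
      then have "even (2 * (x a mod J) + 1)" by (metis dvd_triv_left)
      then show False by simp
    qed
    with * show ?thesis by simp
  qed
  ultimately show ?thesis using Zeq unfolding X_def Z_def by blast
qed

text \<open>Distinct tops in one class have values at least \<open>J\<close> apart. If
  \<open>b' < a'\<close>, the prefix of length \<open>Suc b'\<close> would contain the raise coming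
  from \<open>b\<close> but not the one from \<open>a\<close>; \<open>prefix_bump\<close> excludes
  this.\<close>

lemma bump_raise_order:
  assumes x: "sorted_upto m x" and tops: "is_top m x a" "is_top m x b" and "j < m" "0 \<le> J"
    and ab: "a < b" "x a mod J = x b mod J"
    and a': "bump m (2 * J) j (raise x {a}) = raise y {a'}" "a' < m"
    and b': "bump m (2 * J) j (raise x {b}) = raise y {b'}"
  shows "a' \<le> b'"
proof (rule ccontr)
  assume "\<not> a' \<le> b'"
  define k where "k = Suc b'"
  have k: "k < m" "b' < k" "k \<le> a'" using \<open>\<not> a' \<le> b'\<close> a' by (auto simp: k_def)
  have b: "b < m" "Suc b < m \<Longrightarrow> x b < x (Suc b)" using tops by (auto simp: is_top_def)
  have "x a < x (Suc a)" using tops b ab by (auto simp: is_top_def)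
  also have "\<dots> \<le> x b" using sorted_uptoD[OF x, of "Suc a" b] ab b by simp
  finally have lt: "x a < x b" .
  have "J dvd x b - x a" using ab(2) by (metis mod_eq_dvd_iff)
  then have gap: "x a + J \<le> x b" using lt zdvd_imp_le[of J "x b - x a"] by simp
  have pre: "(\<Sum>l<k. raise z {c} l) = 2 * (\<Sum>l<k. z l) + of_bool (c < k)" for z c
  proof -
    have "{..<k} \<inter> {c} = (if c < k then {c} else {})" by auto
    then show ?thesis
      by (simp add: raise_def sum.distrib sum_distrib_left of_bool_def sum.If_cases)
  qed
  have A: "2 * (\<Sum>l<k. y l) = 2 * (\<Sum>l<k. x l) + of_bool (a < k) +
      (if k \<le> j then 0 else min (2 * J) (raise x {a} k - raise x {a} j))"
    using prefix_bump[of m "raise x {a}" "2 * J" j k] sorted_raise[OF x, of "{a}"] assms k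
    by (simp add: pre)
  have B: "2 * (\<Sum>l<k. y l) + 1 = 2 * (\<Sum>l<k. x l) + of_bool (b < k) +
      (if k \<le> j then 0 else min (2 * J) (raise x {b} k - raise x {b} j))"
    using prefix_bump[of m "raise x {b}" "2 * J" j k] sorted_raise[OF x, of "{b}"] assms k
    by (simp add: pre)
  have "x b < x k" if "b < k"
    using b(2) sorted_uptoD[OF x, of "Suc b" k] that k by simp
  then show False
    \<comment> \<open>The increments differ only through raises at positions \<open>j\<close> and
      \<open>k\<close>, hence the split into coincidences with \<open>a\<close> and
      \<open>b\<close>.\<close>
    using A B gap lt \<open>a < b\<close> assms(5)
    by (cases "j = a"; cases "j = b"; cases "k = a"; cases "k = b"; cases "a < k"; cases "b < k")
      (auto simp: raise_def min_def split: if_splits)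
qed

text \<open>Both raises are followed together, since their order is compared at each intermediate
  vector. Should the positions coincide, they stay together from then on.\<close>

lemma run_raise:
  assumes x: "sorted_upto m x" and "0 \<le> J" "set w \<subseteq> {..<m}"
    and "is_top m x a" "is_top m x b" "a \<le> b" "x a mod J = x b mod J"
  shows "\<exists>a' b'. run m (2 * J) w (raise x {a}) = raise (run m J w x) {a'} \<and>
    run m (2 * J) w (raise x {b}) = raise (run m J w x) {b'} \<and>
    is_top m (run m J w x) a' \<and> is_top m (run m J w x) b' \<and> a' \<le> b' \<and>
    run m J w x a' mod J = x a mod J \<and> run m J w x b' mod J = x b mod J"
  using assms(3)
proof (induction w)
  case Nil
  then show ?case using assms by auto
next
  case (Cons j w)
  let ?x = "run m J w x"
  have j: "j < m" using Cons.prems by simp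
  obtain a' b' where IH: "run m (2 * J) w (raise x {a}) = raise ?x {a'}"
    "run m (2 * J) w (raise x {b}) = raise ?x {b'}" "is_top m ?x a'" "is_top m ?x b'" "a' \<le> b'"
    "?x a' mod J = x a mod J" "?x b' mod J = x b mod J"
    using Cons by auto
  have srt: "sorted_upto m ?x" using x by (rule sorted_upto_run)
  obtain a'' where a'': "bump m (2 * J) j (raise ?x {a'}) = raise (bump m J j ?x) {a''}"
    "is_top m (bump m J j ?x) a''" "bump m J j ?x a'' mod J = ?x a' mod J"
    using bump_raise_ex[OF srt IH(3) j assms(2)] by blast
  obtain b'' where b'': "bump m (2 * J) j (raise ?x {b'}) = raise (bump m J j ?x) {b''}"
    "is_top m (bump m J j ?x) b''" "bump m J j ?x b'' mod J = ?x b' mod J"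
    using bump_raise_ex[OF srt IH(4) j assms(2)] by blast
  show ?case
  proof (cases "a' = b'")
    case True
    then show ?thesis using IH a'' by (intro exI[of _ a'']) auto
  next
    case False
    have "a'' \<le> b''"
      using False IH assms(7) a'' b''
      by (intro bump_raise_order[OF srt IH(3,4) j assms(2)]) (auto simp: is_top_def)
    then show ?thesis using IH a'' b'' by (intro exI[of _ a''] exI[of _ b'']) auto
  qed
qed

section \<open>Separating entries with equal residues\<close>

text \<open>A move changes the class by \<open>- N\<close>, so a cycle that closes up at its first
  return to the class of \<open>p\<close> and \<open>q\<close> meets that class once. Raising along
  it is consistent with the equation and splits the class.\<close>

lemma split_residues:
  assumes J: "0 < J" and w: "set w \<subseteq> {..<m}" and x: "sorted_upto m x"
    and fixed: "\<And>i. i < m \<Longrightarrow> run m J w x i = x i + N"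
    and pq: "p < m" "q < m" "p \<noteq> q" "x p mod J = x q mod J"
  obtains y where "sorted_upto m y" "\<And>i. i < m \<Longrightarrow> run m (2 * J) w y i = y i + 2 * N"
    "card ((\<lambda>i. x i mod J) ` {..<m}) < card ((\<lambda>i. y i mod (2 * J)) ` {..<m})"
proof -
  define T where "T = {a. is_top m x a}"
  \<comment> \<open>After one run, the raise at \<open>a\<close> reappears at \<open>b\<close>, up
    to the translation by \<open>2 * N\<close>.\<close>
  define moves where "moves a b \<longleftrightarrow> b \<in> T \<and> (x b + N) mod J = x a mod J \<and>
      (\<forall>i<m. run m (2 * J) w (raise x {a}) i = raise x {b} i + 2 * N)" for a b
  have ltT: "a < m" if "a \<in> T" for a using that by (simp add: T_def is_top_def)
  have uniq: "b = c" if "moves a b" "moves a c" for a b c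
  proof -
    have "raise x {b} b = raise x {c} b"
      using that ltT[of b] unfolding moves_def by (metis add_right_cancel)
    then show ?thesis by (auto simp: raise_def)
  qed
  have pair: "\<exists>a' b'. moves a a' \<and> moves b b' \<and> a' \<le> b'"
    if ab: "a \<in> T" "b \<in> T" "a \<le> b" "x a mod J = x b mod J" for a b
  proof -
    let ?x = "run m J w x"
    obtain a' b' where *: "run m (2 * J) w (raise x {a}) = raise ?x {a'}"
      "run m (2 * J) w (raise x {b}) = raise ?x {b'}" "is_top m ?x a'" "is_top m ?x b'" "a' \<le> b'"
      "?x a' mod J = x a mod J" "?x b' mod J = x b mod J"
      using run_raise[OF x _ w, of J a b] J ab by (auto simp: T_def)
    have "is_top m x a'" "is_top m x b'" using *(3,4) fixed by (auto simp: is_top_def)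
    moreover have "a' < m" "b' < m" using *(3,4) by (auto simp: is_top_def)
    ultimately have "moves a a'" "moves b b'"
      using * fixed by (simp_all add: moves_def T_def raise_def)
    then show ?thesis using *(5) by blast
  qed
  define f where "f a = (THE b. moves a b)" for a
  have f_eq: "f a = b" if "moves a b" for a b
    using that uniq unfolding f_def by blast
  have f: "moves a (f a)" if "a \<in> T" for a using pair[of a a] that f_eq by auto
  have f_mono: "f a \<le> f b" if "a \<in> T" "b \<in> T" "a \<le> b" "x a mod J = x b mod J" for a b
    using pair[OF that] f_eq by blast
  have fk: "(f ^^ k) a \<in> T \<and> (x ((f ^^ k) a) + int k * N) mod J = x a mod J" if "a \<in> T" for a k
  proof (induction k)
    case (Suc k)
    let ?b = "(f ^^ k) a"
    have *: "f ?b \<in> T" "(x (f ?b) + N) mod J = x ?b mod J" using f[of ?b] Suc by (auto simp: moves_def)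
    have "(x (f ?b) + int (Suc k) * N) mod J = ((x (f ?b) + N) mod J + int k * N) mod J"
      by (simp add: algebra_simps mod_simps)
    also have "\<dots> = x a mod J" using Suc by (simp add: * mod_simps)
    finally show ?case using * by simp
  qed (use that in simp)
  have fk_mono: "(f ^^ k) a \<le> (f ^^ k) b"
    if "a \<in> T" "b \<in> T" "a \<le> b" "x a mod J = x b mod J" for a b k
  proof (induction k)
    case (Suc k)
    have "(x ((f ^^ k) a) + int k * N) mod J = (x ((f ^^ k) b) + int k * N) mod J"
      using fk that by simp
    then have "x ((f ^^ k) a) mod J = x ((f ^^ k) b) mod J"
      by (simp add: mod_eq_dvd_iff)
    then show ?case using Suc fk that by (auto intro!: f_mono)
  qed (use that in simp)
  \<comment> \<open>The order of \<open>N\<close> modulo \<open>J\<close>, that is, the first return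
    time to a class; \<open>nat J\<close> witnesses existence.\<close>
  define L where "L = (LEAST L. 0 < L \<and> J dvd int L * N)"
  have "0 < nat J \<and> J dvd int (nat J) * N" using J by simp
  then have L: "0 < L" "J dvd int L * N"
    unfolding L_def by (metis (mono_tags, lifting) LeastI)+
  have L_min: "k = 0" if "k < L" "J dvd int k * N" for k
    using that not_less_Least[of k "\<lambda>L. 0 < L \<and> J dvd int L * N"] by (auto simp: L_def)
  define r where "r = x p mod J"
  \<comment> \<open>\<open>g\<close> is an order preserving self-map of the entries in class \<open>r\<close>, so iterating from the
     last one descends to a fixed entry \<open>c\<close>.\<close>
  define g where "g = f ^^ L"
  define S where "S = {a. a < m \<and> x a mod J = r}"
  have "finite S" "p \<in> S" "q \<in> S" using pq by (auto simp: S_def r_def)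
  \<comment> \<open>A position of \<open>S\<close> need not be a top, but the last one is: an equal
    next entry would lie in \<open>S\<close> too.\<close>
  define t where "t = Max S"
  have t: "t \<in> S" using \<open>finite S\<close> \<open>p \<in> S\<close> by (auto simp: t_def intro: Max_in)
  have t_max: "a \<le> t" if "a \<in> S" for a using that \<open>finite S\<close> by (simp add: t_def)
  have "t \<in> T"
  proof -
    have "x t < x (Suc t)" if "Suc t < m"
    proof (rule ccontr)
      assume "\<not> x t < x (Suc t)"
      then have "x (Suc t) = x t" using x that by (force simp: sorted_upto_def)
      then have "Suc t \<in> S" using t that by (simp add: S_def)
      then show False using t_max by fastforce
    qed
    then show ?thesis using t by (simp add: T_def is_top_def S_def)
  qed
  have g_TS: "g a \<in> T \<inter> S" if "a \<in> T \<inter> S" for a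
  proof -
    have "(x (g a) + int L * N) mod J = x a mod J" "g a \<in> T"
      using fk[of a L] that by (auto simp: g_def)
    moreover have "(x (g a) + int L * N) mod J = x (g a) mod J"
      using L(2) by (simp add: mod_eq_dvd_iff)
    ultimately show ?thesis using that ltT[of "g a"] by (auto simp: S_def)
  qed
  have gk: "(g ^^ k) t \<in> T \<inter> S" for k
    by (induction k) (use g_TS \<open>t \<in> T\<close> t in auto)
  have g_mono: "g a \<le> g b" if "a \<in> T \<inter> S" "b \<in> T \<inter> S" "a \<le> b" for a b
    unfolding g_def using that by (intro fk_mono) (auto simp: S_def)
  have g_dec: "(g ^^ Suc k) t \<le> (g ^^ k) t" for k
  proof (induction k)
    case 0
    then show ?case using t_max gk[of 1] by simp
  next
    case (Suc k)
    have "g ((g ^^ Suc k) t) \<le> g ((g ^^ k) t)"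
      by (rule g_mono[OF gk gk Suc])
    then show ?case by simp
  qed
  define c where "c = (LEAST i. i \<in> range (\<lambda>k. (g ^^ k) t))"
  have "t \<in> range (\<lambda>k. (g ^^ k) t)" by (rule range_eqI[of _ _ 0]) simp
  then have "c \<in> range (\<lambda>k. (g ^^ k) t)" unfolding c_def by (rule LeastI)
  then obtain k where k: "c = (g ^^ k) t" by blast
  have "g c = (g ^^ Suc k) t" using k by simp
  then have "c \<le> g c" unfolding c_def by (metis Least_le rangeI)
  then have gc: "g c = c" using g_dec[of k] k by simp
  have c: "c \<in> T" "c \<in> S" using gk[of k] k by auto
  define A where "A = (\<lambda>k. (f ^^ k) c) ` {..<L}"
  have A_T: "A \<subseteq> T" using fk c by (auto simp: A_def)
  have A_pre: "\<exists>a\<in>A. f a = b" if "b \<in> A" for b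
  proof -
    have "b \<in> (\<lambda>k. (f ^^ k) c) ` {..<L}" using that by (simp add: A_def)
    then obtain l where l: "l < L" "b = (f ^^ l) c" by blast
    \<comment> \<open>\<open>c\<close> is reached from the last point of the cycle because
      \<open>g c = c\<close>.\<close>
    define l' where "l' = (if l = 0 then L - 1 else l - 1)"
    have "(f ^^ Suc l') c = b"
      using l gc L(1) by (cases l) (auto simp: l'_def g_def simp del: funpow.simps)
    moreover have "(f ^^ l') c \<in> A" using l by (auto simp: A_def l'_def)
    ultimately show ?thesis by auto
  qed
  have A_S: "a = c" if "a \<in> A" "a \<in> S" for a
  proof -
    have "a \<in> (\<lambda>k. (f ^^ k) c) ` {..<L}" using that by (simp add: A_def)
    then obtain l where l: "l < L" "a = (f ^^ l) c" by blast
    have "(x a + int l * N) mod J = x a mod J" using fk[OF c(1), of l] l that c by (auto simp: S_def)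
    then have "J dvd int l * N" by (simp add: mod_eq_dvd_iff)
    then show ?thesis using L_min l by fastforce
  qed
  define y where "y = raise x A"
  have y: "sorted_upto m y" unfolding y_def using A_T by (intro sorted_raise x) (auto simp: T_def)
  \<comment> \<open>At a raised \<open>i\<close>, monotonicity compares with the single raise at its
    predecessor, elsewhere with \<open>2 * x\<close>. Equal sums then force equality.\<close>
  have ge: "y i + 2 * N \<le> run m (2 * J) w y i" if i: "i < m" for i
  proof (cases "i \<in> A")
    case True
    then obtain a where a: "a \<in> A" "f a = i" using A_pre by blast
    have "raise x {i} i + 2 * N = run m (2 * J) w (raise x {a}) i"
      using f[of a] a A_T i by (auto simp: moves_def)
    also have "\<dots> \<le> run m (2 * J) w y i"
      using a by (intro run_mono w i) (auto simp: y_def raise_def)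
    finally show ?thesis using True by (simp add: y_def raise_def)
  next
    case False
    have "2 * (x i + N) = run m (2 * J) w (\<lambda>i. 2 * x i) i"
      using fixed i by (simp add: run_double)
    also have "\<dots> \<le> run m (2 * J) w y i"
      by (intro run_mono w i) (auto simp: y_def raise_def)
    finally show ?thesis using False by (simp add: y_def raise_def)
  qed
  have "(\<Sum>i<m. x i + N) = (\<Sum>i<m. x i) + J * int (length w)"
    using sum_run_step[where h = "\<lambda>v. v" and c = J, OF x _ w] J fixed by simp
  moreover have "(\<Sum>i<m. run m (2 * J) w y i) = (\<Sum>i<m. y i) + 2 * J * int (length w)"
    using sum_run_step[where h = "\<lambda>v. v" and c = "2 * J", OF y _ w] J by simp
  ultimately have "(\<Sum>i<m. y i + 2 * N) = (\<Sum>i<m. run m (2 * J) w y i)"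
    by (simp add: sum.distrib)
  then have "run m (2 * J) w y i = y i + 2 * N" if "i < m" for i
    using sum_mono_inv[of "\<lambda>i. y i + 2 * N" "{..<m}" "run m (2 * J) w y" i] ge that by simp
  moreover have "card ((\<lambda>i. x i mod J) ` {..<m}) < card ((\<lambda>i. y i mod (2 * J)) ` {..<m})"
  proof -
    let ?Y = "(\<lambda>i. y i mod (2 * J)) ` {..<m}"
    have mod: "y i mod (2 * J) = 2 * (x i mod J) + of_bool (i \<in> A)" for i
      using J by (simp add: y_def raise_mod)
    \<comment> \<open>Halving maps new residues onto old ones. It identifies those of
      \<open>c\<close>, which was raised, and of some \<open>b\<close> in \<open>S\<close>, which
      was not, so the number of residues grows.\<close>
    have img: "(\<lambda>i. x i mod J) ` {..<m} = (\<lambda>v. v div 2) ` ?Y"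
      unfolding image_image mod by simp
    obtain b where b: "b \<in> S" "b \<noteq> c" using \<open>p \<in> S\<close> \<open>q \<in> S\<close> pq(3) by metis
    have "c \<in> A" using L(1) by (auto simp: A_def intro: image_eqI[of _ _ 0])
    have "b \<notin> A" using A_S b by blast
    have "\<not> inj_on (\<lambda>v. v div 2) ?Y"
    proof
      assume "inj_on (\<lambda>v. v div 2) ?Y"
      moreover have "y b mod (2 * J) div 2 = y c mod (2 * J) div 2"
        using b(1) c(2) by (simp add: mod S_def)
      moreover have "b < m" "c < m" using b c by (auto simp: S_def)
      ultimately have "y b mod (2 * J) = y c mod (2 * J)" by (auto dest: inj_onD)
      then have "2 * (x b mod J) = 2 * (x c mod J) + 1"
        using \<open>c \<in> A\<close> \<open>b \<notin> A\<close> by (simp add: mod)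
      moreover have "x b mod J = x c mod J" using b(1) c(2) by (simp add: S_def)
      ultimately show False by simp
    qed
    then have "card ((\<lambda>v. v div 2) ` ?Y) \<noteq> card ?Y" using eq_card_imp_inj_on by blast
    moreover have "card ((\<lambda>v. v div 2) ` ?Y) \<le> card ?Y" by (rule card_image_le) simp
    ultimately show ?thesis unfolding img by linarith
  qed
  ultimately show ?thesis using y that by blast
qed

text \<open>\<open>split_residues\<close> is iterated until no residues collide; there are at most
  \<open>m\<close> of them, so this stops. \<open>M\<close> accumulates the doublings.\<close>

lemma ex_fixed_distinct_residues:
  assumes "0 < m" "set w \<subseteq> {..<m}" "sorted_upto m x"
    and "\<And>i. i < m \<Longrightarrow> run m (M * int m) w x i = x i + M * N" "0 < M"
  shows "\<exists>M>0. \<exists>y. sorted_upto m y \<and> (\<forall>i<m. run m (M * int m) w y i = y i + M * N) \<and>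
    inj_on (\<lambda>i. y i mod (M * int m)) {..<m}"
  using assms(3-5)
proof (induction "m - card ((\<lambda>i. x i mod (M * int m)) ` {..<m})" arbitrary: x M rule: less_induct)
  case less
  show ?case
  proof (cases "inj_on (\<lambda>i. x i mod (M * int m)) {..<m}")
    case False
    then obtain p q where "p < m" "q < m" "p \<noteq> q" "x p mod (M * int m) = x q mod (M * int m)"
      by (auto simp: inj_on_def)
    then obtain y where y: "sorted_upto m y"
      "\<And>i. i < m \<Longrightarrow> run m (2 * (M * int m)) w y i = y i + 2 * (M * N)"
      "card ((\<lambda>i. x i mod (M * int m)) ` {..<m}) < card ((\<lambda>i. y i mod (2 * (M * int m))) ` {..<m})"
      using split_residues[of "M * int m" w m x "M * N" p q] less.prems assms(1,2) by auto
    have "card ((\<lambda>i. y i mod (2 * (M * int m))) ` {..<m}) \<le> m"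
      using card_image_le[of "{..<m}" "\<lambda>i. y i mod (2 * (M * int m))"] by simp
    then show ?thesis
      using less.hyps[of y "2 * M"] y less.prems by (simp add: mult.assoc)
  qed (use less.prems in blast)
qed

section \<open>Return to the original scale\<close>

text \<open>\<open>run_comp\<close> transports the scaled solution along \<open>\<psi>\<close>,
  which is monotone, turns steps \<open>J\<close> and \<open>M * n\<close> into \<open>m\<close> and
  \<open>n\<close>, and keeps residues distinct.\<close>

lemma ex_fixed_complete:
  assumes "0 < m" and w: "set w \<subseteq> {..<m}"
    and parking: "\<And>i. i \<le> m \<Longrightarrow> i * length w \<le> m * length (filter (\<lambda>a. a < i) w)"
  obtains y where "sorted_upto m y" "\<And>i. i < m \<Longrightarrow> run m (int m) w y i = y i + int (length w)"
    "inj_on (\<lambda>i. y i mod int m) {..<m}"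
proof -
  define n where "n = length w"
  obtain x0 where "sorted_upto m x0" "\<And>i. i < m \<Longrightarrow> run m (int m) w x0 i = x0 i + int n"
    using ex_fixed_vector[OF assms] unfolding n_def by blast
  then obtain M x where "0 < M" and x: "sorted_upto m x"
    and fixed: "\<And>i. i < m \<Longrightarrow> run m (M * int m) w x i = x i + M * int n"
    and inj: "inj_on (\<lambda>i. x i mod (M * int m)) {..<m}"
    using ex_fixed_distinct_residues[of m w x0 1 "int n"] assms(1) w by auto
  define J where "J = M * int m"
  have J: "0 < J" using \<open>0 < M\<close> assms(1) by (simp add: J_def)
  \<comment> \<open>\<open>h v u\<close> is \<open>(v - u) / J\<close> rounded up, so \<open>\<psi>\<close> counts the \<open>x i + k J\<close> below \<open>v\<close>, suitably
     normalised.\<close>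
  define h where "h v u = - ((u - v) div J)" for v u
  define \<psi> where "\<psi> v = (\<Sum>i<m. h v (x i))" for v
  have h_mono: "h u z \<le> h v z" if "u \<le> v" for u v z
    using that J by (simp add: h_def zdiv_mono1)
  have h_shift: "h (v + J) u = h v u + 1" "h v (u + J) = h v u - 1" for v u
  proof -
    have "u - (v + J) = (u - v) + (- 1) * J" "u + J - v = (u - v) + 1 * J" by simp_all
    then show "h (v + J) u = h v u + 1" "h v (u + J) = h v u - 1"
      using J by (simp_all only: h_def div_mult_self1)
  qed
  have mono: "mono \<psi>" by (auto simp: mono_def \<psi>_def intro!: sum_mono h_mono)
  have shift: "\<psi> (v + J) = \<psi> v + int m" for v by (simp add: \<psi>_def h_shift sum.distrib)
  \<comment> \<open>Translating both arguments of \<open>h\<close> by \<open>?N\<close> changes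
    nothing, and \<open>x\<close> translated by \<open>?N\<close> is the run of \<open>x\<close>,
    whose \<open>n\<close> letters each lower the sum by 1.\<close>
  have shift_n: "\<psi> (v + M * int n) = \<psi> v + int n" for v
  proof -
    let ?N = "M * int n"
    have "\<psi> v = (\<Sum>i<m. h (v + ?N) (x i + ?N))" by (simp add: \<psi>_def h_def)
    also have "\<dots> = (\<Sum>i<m. h (v + ?N) (run m J w x i))" using fixed by (simp add: J_def)
    also have "\<dots> = \<psi> (v + ?N) - int n"
      using sum_run_step[where h = "h (v + ?N)" and c = "- 1", OF x _ w, of J] J
      by (simp add: \<psi>_def h_shift n_def)
    finally show ?thesis by simp
  qed
  \<comment> \<open>The summand of \<open>x i\<close> jumps just after \<open>x i + k * J\<close>,
    so \<open>\<psi>\<close> is injective on these points.\<close>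
  have strict: "\<psi> (x i + k * J) < \<psi> v" if "i < m" "x i + k * J < v" for i k v
  proof -
    have "h (x i + k * J) (x i) = k"
      using J nonzero_mult_div_cancel_right[of J "- k"] by (simp add: h_def)
    moreover have "k < h v (x i)"
    proof -
      have "x i - v < (- k) * J" using that by simp
      then have "(x i - v) div J * J < (- k) * J"
        using div_mult_mod_eq[of "x i - v" J] pos_mod_sign[OF J, of "x i - v"] by linarith
      then have "(x i - v) div J < - k" using J by (auto simp only: mult_less_cancel_right)
      then show ?thesis by (simp add: h_def)
    qed
    ultimately show ?thesis unfolding \<psi>_def
      using that by (intro sum_strict_mono_ex1) (auto intro!: h_mono bexI[of _ i])
  qed
  have shift_k: "\<psi> (v + int k * J) = \<psi> v + int k * int m" for v k
  proof (induction k)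
    case (Suc k)
    then show ?case using shift[of "v + int k * J"] by (simp add: algebra_simps)
  qed simp
  have shift_z: "\<psi> (v + k * J) = \<psi> v + k * int m" for v k
  proof (cases "0 \<le> k")
    case True
    then show ?thesis using shift_k[of v "nat k"] by simp
  next
    case False
    then show ?thesis using shift_k[of "v + k * J" "nat (- k)"] by (simp add: algebra_simps)
  qed
  define y where "y i = \<psi> (x i)" for i
  have run_y: "run m (int m) w y = (\<lambda>i. \<psi> (run m J w x i))"
    unfolding y_def by (rule run_comp[OF mono shift])
  show ?thesis
  proof (rule that)
    show "sorted_upto m y" using x mono by (simp add: sorted_upto_def y_def monoD)
    show "run m (int m) w y i = y i + int (length w)" if "i < m" for i
      using fixed[OF that] by (simp add: run_y y_def shift_n flip: J_def n_def)
    show "inj_on (\<lambda>i. y i mod int m) {..<m}"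
    proof (rule inj_onI)
      fix i l assume il: "i \<in> {..<m}" "l \<in> {..<m}" "y i mod int m = y l mod int m"
      then obtain k where "y l = y i + k * int m"
        by (metis mod_eqE mult.commute)
      then have "\<psi> (x l + 0 * J) = \<psi> (x i + k * J)" by (simp add: y_def shift_z)
      then have "x l = x i + k * J"
        using strict[of l 0 "x i + k * J"] strict[of i k "x l"] il
        by (cases "x l" "x i + k * J" rule: linorder_cases) auto
      then have "x i mod J = x l mod J" by simp
      then show "i = l" using inj il by (auto simp: J_def dest: inj_onD)
    qed
  qed
qed

section \<open>Translation between vectors and invariant sets\<close>

text \<open>The smallest \<open>m\<close>-invariant set containing the entries; when their residues
  are distinct, they are its generators.\<close>

definition upset :: "nat \<Rightarrow> (nat \<Rightarrow> int) \<Rightarrow> int set" where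
  "upset m x = {v. \<exists>i<m. x i \<le> v \<and> v mod int m = x i mod int m}"

abbreviation distinct_residues :: "nat \<Rightarrow> (nat \<Rightarrow> int) \<Rightarrow> bool" where
  "distinct_residues m x \<equiv> inj_on (\<lambda>i. x i mod int m) {..<m}"

text \<open>Pigeonhole with \<open>m\<close> entries and \<open>m\<close> classes. The covering form
  suits counting with \<open>sum_bump\<close>.\<close>

lemma distinct_residues_iff:
  assumes "0 < m"
  shows "distinct_residues m x \<longleftrightarrow> (\<forall>r\<in>{0..<int m}. \<exists>i<m. x i mod int m = r)"
proof -
  have sub: "(\<lambda>i. x i mod int m) ` {..<m} \<subseteq> {0..<int m}" using assms by auto
  have "distinct_residues m x \<longleftrightarrow> card ((\<lambda>i. x i mod int m) ` {..<m}) = card {0..<int m}"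
    by (auto simp: inj_on_iff_eq_card)
  also have "\<dots> \<longleftrightarrow> (\<lambda>i. x i mod int m) ` {..<m} = {0..<int m}"
    using card_subset_eq[OF _ sub] by auto
  also have "\<dots> \<longleftrightarrow> {0..<int m} \<subseteq> (\<lambda>i. x i mod int m) ` {..<m}" using sub by blast
  also have "\<dots> \<longleftrightarrow> (\<forall>r\<in>{0..<int m}. \<exists>i<m. x i mod int m = r)" 
    unfolding subset_iff image_iff Ball_def Bex_def lessThan_iff by metis
  finally show ?thesis .
qed

lemma distinct_residues_bump:
  assumes "sorted_upto m x" "distinct_residues m x" "j < m"
  shows "distinct_residues m (bump m (int m) j x)"
proof -
  have m: "0 < m" using assms by simp
  have "\<exists>i<m. bump m (int m) j x i mod int m = r" if r: "r \<in> {0..<int m}" for r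
  proof -
    define h :: "int \<Rightarrow> nat" where "h v = of_bool (v mod int m = r)" for v
    obtain i where "i < m" "x i mod int m = r"
      using assms(2) r unfolding distinct_residues_iff[OF m] by blast
    then have "i < m" "h (x i) \<noteq> 0" by (simp_all add: h_def)
    then have "(\<Sum>l<m. h (x l)) \<noteq> 0" by auto
    moreover have "(\<Sum>l<m. h (bump m (int m) j x l)) = (\<Sum>l<m. h (x l))"
      using sum_bump[of m x "int m" j h] assms by (simp add: h_def)
    ultimately obtain l where "l < m" "h (bump m (int m) j x l) \<noteq> 0"
      by (metis lessThan_iff sum.neutral)
    then show ?thesis by (auto simp: h_def split: if_splits)
  qed
  then show ?thesis unfolding distinct_residues_iff[OF m] by blast
qed

lemma strict_sorted_upto:
  assumes "sorted_upto m x" "distinct_residues m x" "i < k" "k < m"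
  shows "x i < x k"
proof -
  have "x i \<noteq> x k" using inj_onD[OF assms(2), of i k] assms(3,4) by auto
  then show ?thesis using sorted_uptoD[OF assms(1), of i k] assms(3,4) by simp
qed

lemma shift_iff: "v \<in> shift \<Delta> k \<longleftrightarrow> v - int k \<in> \<Delta>"
  unfolding shift_def by (metis (no_types, lifting) add_diff_cancel diff_add_cancel image_iff)

lemma shift_upset: "shift (upset m x) k = upset m (\<lambda>i. x i + int k)"
proof -
  have "(v - int k) mod int m = x i mod int m \<longleftrightarrow> v mod int m = (x i + int k) mod int m" for v i
    by (simp add: mod_eq_dvd_iff algebra_simps)
  then show ?thesis by (auto simp: set_eq_iff shift_iff upset_def)
qed

lemma generators_upset:
  assumes "distinct_residues m x"
  shows "generators m (upset m x) = x ` {..<m}"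
proof -
  have "v \<in> generators m (upset m x) \<longleftrightarrow> v \<in> x ` {..<m}" for v
  proof
    assume v: "v \<in> generators m (upset m x)"
    then obtain i where i: "i < m" "x i \<le> v" "v mod int m = x i mod int m"
      by (auto simp: generators_def upset_def)
    have "x i = v"
    proof (rule ccontr)
      assume "x i \<noteq> v"
      moreover have "int m dvd v - x i" using i by (simp add: mod_eq_dvd_iff)
      ultimately have "int m \<le> v - x i" using i zdvd_imp_le by simp
      then have "v - int m \<in> upset m x" using i by (auto simp: upset_def)
      then show False using v by (simp add: generators_def shift_iff)
    qed
    then show "v \<in> x ` {..<m}" using i by auto
  next
    assume "v \<in> x ` {..<m}"
    then obtain i where i: "i < m" "v = x i" by auto
    have "l = i" if "l < m" "x i mod int m = x l mod int m" for l
      using inj_onD[OF assms, of l i] that i by simp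
    then show "v \<in> generators m (upset m x)"
      using i by (fastforce simp: generators_def upset_def shift_iff)
  qed
  then show ?thesis by blast
qed

lemma generator_upset:
  assumes "sorted_upto m x" "distinct_residues m x" "i < m"
  shows "generator m (upset m x) i = x i"
proof -
  have "sorted_wrt (<) (map x [0..<m])"
    by (auto simp: sorted_wrt_iff_nth_less intro: strict_sorted_upto[OF assms(1,2)])
  then have "sorted_list_of_set (x ` {..<m}) = map x [0..<m]"
    by (intro sorted_list_of_set_unique[THEN iffD1])
      (auto simp: lessThan_atLeast0 strict_sorted_iff dest!: distinct_card)
  then show ?thesis using assms by (simp add: generator_def generators_upset)
qed

text \<open>Membership of \<open>v\<close> means that some entry of its class is at most
  \<open>v\<close>. By \<open>sum_bump\<close>, trading \<open>x j\<close> for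
  \<open>x j + m\<close> alters the number of such entries only at \<open>v = x j\<close> among the
  members of that class below \<open>x j + m\<close>, where it falls from 1 to 0.\<close>

lemma act_letter_upset:
  assumes "sorted_upto m x" "distinct_residues m x" "j < m"
  shows "act_letter m j (upset m x) = upset m (bump m (int m) j x)"
proof -
  let ?y = "bump m (int m) j x"
  have "v \<in> upset m ?y \<longleftrightarrow> v \<in> upset m x \<and> v \<noteq> x j" for v
  proof -
    define h :: "int \<Rightarrow> nat" where "h u = of_bool (u \<le> v \<and> v mod int m = u mod int m)" for u
    have upset_iff: "v \<in> upset m z \<longleftrightarrow> (\<Sum>l<m. h (z l)) \<noteq> 0" for z
      by (auto simp: upset_def h_def)
    have eq: "(\<Sum>l<m. h (?y l)) + h (x j) = (\<Sum>l<m. h (x l)) + h (x j + int m)"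
      using assms by (intro sum_bump) auto
    show ?thesis
    proof (cases "v = x j")
      case True
      have "h (x l) = of_bool (l = j)" if "l < m" for l
        using inj_onD[OF assms(2), of l j] that assms(3) True by (auto simp: h_def)
      then have "(\<Sum>l<m. h (x l)) = (\<Sum>l<m. of_bool (l = j))" by (intro sum.cong) auto
      also have "\<dots> = 1" using assms(3) by (simp add: of_bool_def)
      finally have "(\<Sum>l<m. h (?y l)) = 0" using eq True assms(3) by (simp add: h_def)
      then show ?thesis using upset_iff[of ?y] True by metis
    next
      case False
      have "x j + int m \<le> v" if "x j \<le> v" "v mod int m = x j mod int m"
        using False that zdvd_imp_le[of "int m" "v - x j"] by (simp add: mod_eq_dvd_iff)
      then have "h (x j + int m) = h (x j)" by (auto simp: h_def)
      then show ?thesis using eq False by (simp add: upset_iff)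
    qed
  qed
  then show ?thesis using generator_upset[OF assms] by (auto simp: act_letter_def)
qed

lemma act_word_upset:
  assumes "sorted_upto m x" "distinct_residues m x" "set w \<subseteq> {..<m}"
  shows "act_word m w (upset m x) = upset m (run m (int m) w x) \<and>
    distinct_residues m (run m (int m) w x)"
  using assms(3)
  by (induction w) (auto simp: act_word_def assms act_letter_upset distinct_residues_bump
      sorted_upto_run)

lemma upset_bounded:
  assumes "0 < m" "sorted_upto m x"
  shows "bounded_set (upset m x)"
  unfolding bounded_set_def
proof (intro bexI ballI)
  show "x 0 \<in> upset m x" using assms by (auto simp: upset_def)
  fix v assume "v \<in> upset m x"
  then show "x 0 \<le> v" using sorted_uptoD[OF assms(2), of 0] by (fastforce simp: upset_def)
qed

lemma upset_cobounded:
  assumes "0 < m" "sorted_upto m x" "distinct_residues m x"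
  shows "cobounded_set (upset m x)"
  unfolding cobounded_set_def
proof (intro exI subsetI)
  fix v assume "v \<in> {x (m - 1)..}"
  moreover obtain i where "i < m" "x i mod int m = v mod int m"
    using bspec[OF assms(3)[unfolded distinct_residues_iff[OF assms(1)]], of "v mod int m"] assms(1)
    by auto
  moreover have "x i \<le> x (m - 1)" if "i < m" for i
    using that by (intro sorted_uptoD[OF assms(2)]) auto
  ultimately show "v \<in> upset m x" by (fastforce simp: upset_def)
qed

lemma upset_invariant: "invariant_set m (upset m x)"
  unfolding invariant_set_def shift_upset by (auto simp: upset_def)

text \<open>Co-boundedness makes every class meet the set and boundedness gives it a least element
  there; these elements, sorted, form \<open>x\<close>.\<close>

lemma ex_upset:
  assumes m: "0 < m" and "bounded_set \<Delta>" "cobounded_set \<Delta>" "invariant_set m \<Delta>"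
  obtains x where "sorted_upto m x" "distinct_residues m x" "\<Delta> = upset m x"
proof -
  obtain b where b: "\<And>v. v \<in> \<Delta> \<Longrightarrow> b \<le> v" using assms by (auto simp: bounded_set_def)
  obtain K where K: "\<And>v. K \<le> v \<Longrightarrow> v \<in> \<Delta>" using assms by (auto simp: cobounded_set_def)
  have inv: "v + int m \<in> \<Delta>" if "v \<in> \<Delta>" for v
    using that assms(4) by (auto simp: invariant_set_def shift_def)
  have invk: "v + int k * int m \<in> \<Delta>" if "v \<in> \<Delta>" for v k
  proof (induction k)
    case (Suc k)
    then show ?case using inv[of "v + int k * int m"] by (simp add: algebra_simps)
  qed (use that in simp)
  have up: "v \<in> \<Delta>" if "u \<in> \<Delta>" "u \<le> v" "v mod int m = u mod int m" for u v
  proof -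
    have "int m dvd v - u" using that(3) by (simp add: mod_eq_dvd_iff)
    then obtain k where k: "v - u = int m * k" by (rule dvdE)
    have "0 \<le> int m * k" using that(2) k by simp
    then have "0 \<le> k" using m by (simp add: zero_le_mult_iff)
    with k have "v = u + int (nat k) * int m" by (simp add: algebra_simps)
    then show ?thesis using invk that(1) by metis
  qed
  have ex_least: "\<exists>a\<in>\<Delta>. a mod int m = r \<and> (\<forall>v\<in>\<Delta>. v mod int m = r \<longrightarrow> a \<le> v)"
    if r: "r \<in> {0..<int m}" for r
  proof -
    \<comment> \<open>Measuring from \<open>b\<close> lets \<open>LEAST\<close> range over naturals;
      \<open>u\<close> below is a member of class \<open>r\<close> beyond both \<open>K\<close> and
      \<open>b\<close>.\<close>
    define P where "P k \<longleftrightarrow> b + int k \<in> \<Delta> \<and> (b + int k) mod int m = r" for k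
    define u where "u = r + int m * (\<bar>K\<bar> + \<bar>b\<bar> + \<bar>r\<bar>)"
    have "1 * (\<bar>K\<bar> + \<bar>b\<bar> + \<bar>r\<bar>) \<le> int m * (\<bar>K\<bar> + \<bar>b\<bar> + \<bar>r\<bar>)"
      using m by (intro mult_right_mono) auto
    then have "K \<le> u" "b \<le> u" by (auto simp: u_def)
    moreover have "u mod int m = r" using r by (simp add: u_def)
    ultimately have "P (nat (u - b))" using K by (simp add: P_def)
    then have least: "P (LEAST k. P k)" by (rule LeastI)
    have "b + int (LEAST k. P k) \<le> v" if "v \<in> \<Delta>" "v mod int m = r" for v
    proof -
      have "P (nat (v - b))" using that b by (simp add: P_def)
      then have "(LEAST k. P k) \<le> nat (v - b)" by (rule Least_le)
      then show ?thesis using b[OF that(1)] by linarith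
    qed
    then show ?thesis using least by (auto simp: P_def)
  qed
  then obtain a where a: "\<And>r. r \<in> {0..<int m} \<Longrightarrow> a r \<in> \<Delta> \<and> a r mod int m = r"
    and a_le: "\<And>r v. r \<in> {0..<int m} \<Longrightarrow> v \<in> \<Delta> \<Longrightarrow> v mod int m = r \<Longrightarrow> a r \<le> v"
    by metis
  define A where "A = a ` {0..<int m}"
  have "inj_on a {0..<int m}" using a by (metis inj_onI)
  then have A: "finite A" "card A = m" by (simp_all add: A_def card_image)
  define xs where "xs = sorted_list_of_set A"
  have xs: "set xs = A" "length xs = m" "sorted xs" using A by (simp_all add: xs_def)
  have im: "(!) xs ` {..<m} = A" using xs by (auto simp: set_conv_nth)
  show ?thesis
  proof (rule that)
    show "sorted_upto m ((!) xs)" using xs by (simp add: sorted_upto_def sorted_iff_nth_Suc)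
    show "distinct_residues m ((!) xs)"
      unfolding distinct_residues_iff[OF m]
    proof
      fix r assume r: "r \<in> {0..<int m}"
      then have "a r \<in> (!) xs ` {..<m}" unfolding im A_def by simp
      then show "\<exists>i<m. xs ! i mod int m = r" using a[OF r] by auto
    qed
    show "\<Delta> = upset m ((!) xs)"
    proof (intro set_eqI iffI)
      fix v assume v: "v \<in> \<Delta>"
      have r: "v mod int m \<in> {0..<int m}" using m by simp
      then have "a (v mod int m) \<in> (!) xs ` {..<m}" unfolding im A_def by simp
      then show "v \<in> upset m ((!) xs)" using a[OF r] a_le[OF r v] by (auto simp: upset_def)
    next
      fix v assume "v \<in> upset m ((!) xs)"
      then obtain i where i: "i < m" "xs ! i \<le> v" "v mod int m = xs ! i mod int m"
        by (auto simp: upset_def)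
      then have "xs ! i \<in> A" using im by blast
      then have "xs ! i \<in> \<Delta>" using a by (auto simp: A_def)
      then show "v \<in> \<Delta>" using i up by blast
    qed
  qed
qed

section \<open>The parking condition and the conclusion\<close>

text \<open>Reversing the word does not affect the counts, clearing the denominator leaves naturals,
  and the added case \<open>i = 0\<close> is trivial.\<close>

lemma parking_function_iff:
  assumes "0 < m"
  shows "parking_function m n w \<longleftrightarrow> length w = n \<and> set w \<subseteq> {..<m} \<and>
    (\<forall>i\<le>m. i * length w \<le> m * length (filter (\<lambda>a. a < i) w))"
proof -
  have count: "card {j \<in> {..<n}. letter w j < i} = length (filter (\<lambda>a. a < i) w)"
    if "length w = n" for i
  proof -
    have "{j \<in> {..<n}. letter w j < i} = {j. j < length (rev w) \<and> rev w ! j < i}"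
      using that by (auto simp: letter_def rev_nth)
    then have "card {j \<in> {..<n}. letter w j < i} = length (filter (\<lambda>a. a < i) (rev w))"
      by (simp only: length_filter_conv_card)
    then show ?thesis by (simp flip: rev_filter)
  qed
  have real_iff: "real c \<ge> real i * real n / real m \<longleftrightarrow> i * n \<le> m * c" for c i
    using assms by (simp add: field_simps flip: of_nat_mult)
  have "(\<forall>i\<in>{1..m}. i * n \<le> m * c i) \<longleftrightarrow> (\<forall>i\<le>m. i * n \<le> m * c i)" for c
    by (metis (no_types) One_nat_def Suc_leI atLeastAtMost_iff mult_is_0 neq0_conv zero_le)
  then show ?thesis
    by (cases "length w = n") (simp_all add: parking_function_def words_def real_iff count
        del: One_nat_def lessThan_iff)
qed

theorem theorem1p1:
  fixes m n :: nat
  assumes "m > 0" and "n > 0"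
  shows "(\<forall>w \<Delta>. w \<in> words m n \<longrightarrow> bounded_set \<Delta> \<longrightarrow> cobounded_set \<Delta> \<longrightarrow> invariant_set m \<Delta> \<longrightarrow>
            act_word m w \<Delta> = shift \<Delta> n \<longrightarrow>
            parking_function m n w \<and> biinvariant_set m n \<Delta>) \<and>
         (\<forall>w. parking_function m n w \<longrightarrow>
            (\<exists>\<Delta>. biinvariant_set m n \<Delta> \<and> bounded_set \<Delta> \<and> cobounded_set \<Delta> \<and>
                 act_word m w \<Delta> = shift \<Delta> n))"
proof -
  \<comment> \<open>Letters only delete elements, which already gives
    \<open>n\<close>-invariance.\<close>
  have "act_word m w \<Delta> \<subseteq> \<Delta>" for w \<Delta>
    by (induction w) (auto simp: act_word_def act_letter_def)
  then have invariant: "invariant_set n \<Delta>" if "act_word m w \<Delta> = shift \<Delta> n" for w \<Delta>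
    using that unfolding invariant_set_def by metis
  have parking: "parking_function m n w"
    if word: "w \<in> words m n"
      and good: "bounded_set \<Delta>" "cobounded_set \<Delta>" "invariant_set m \<Delta>"
      and act: "act_word m w \<Delta> = shift \<Delta> n" for w \<Delta>
  proof -
    have w: "length w = n" "set w \<subseteq> {..<m}" using word by (auto simp: words_def)
    obtain x where x: "sorted_upto m x" "distinct_residues m x" "\<Delta> = upset m x"
      using ex_upset[OF assms(1) good] .
    let ?y = "run m (int m) w x"
    have y: "upset m ?y = upset m (\<lambda>i. x i + int n)" "distinct_residues m ?y"
      using act_word_upset[OF x(1,2) w(2)] act x(3) by (simp_all add: shift_upset)
    have "distinct_residues m (\<lambda>i. x i + int n)"
      using x(2) by (auto simp: inj_on_def mod_eq_dvd_iff)
    \<comment> \<open>Two sorted vectors with distinct residues that describe the same set agree,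
      because \<open>generator\<close> reads off their entries.\<close>
    then have fixed: "?y i = x i + int n" if "i < m" for i
      using generator_upset[OF sorted_upto_run[OF x(1)] y(2) that]
        generator_upset[of m "\<lambda>i. x i + int n" i] x(1) that
      by (simp add: y(1) sorted_upto_def)
    have "i * length w \<le> m * length (filter (\<lambda>a. a < i) w)" if "i \<le> m" for i
    proof -
      have "(\<Sum>l<i. ?y l) = (\<Sum>l<i. x l) + int (i * n)"
        using fixed that by (simp add: sum.distrib)
      moreover have "(\<Sum>l<i. ?y l) \<le> (\<Sum>l<i. x l) + int m * int (length (filter (\<lambda>a. a < i) w))"
        using that by (intro prefix_run_le x(1) w(2)) simp_all
      ultimately show ?thesis by (simp add: w(1) flip: of_nat_mult)
    qed
    then show ?thesis using w unfolding parking_function_iff[OF assms(1)] by blast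
  qed
  have "\<exists>\<Delta>. biinvariant_set m n \<Delta> \<and> bounded_set \<Delta> \<and> cobounded_set \<Delta> \<and>
      act_word m w \<Delta> = shift \<Delta> n" if "parking_function m n w" for w
  proof -
    have w: "length w = n" "set w \<subseteq> {..<m}"
      "\<And>i. i \<le> m \<Longrightarrow> i * length w \<le> m * length (filter (\<lambda>a. a < i) w)"
      using that unfolding parking_function_iff[OF assms(1)] by blast+
    obtain y where y: "sorted_upto m y" "distinct_residues m y"
      "\<And>i. i < m \<Longrightarrow> run m (int m) w y i = y i + int n"
      using ex_fixed_complete[OF assms(1) w(2,3)] w(1) by blast
    have "act_word m w (upset m y) = shift (upset m y) n"
      using act_word_upset[OF y(1,2) w(2)] y(3)
      unfolding shift_upset by (auto simp: upset_def)
    then show ?thesis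
      using upset_bounded[OF assms(1) y(1)] upset_cobounded[OF assms(1) y(1,2)]
        upset_invariant[of m y] invariant
      by (auto simp: biinvariant_set_def)
  qed
  with parking invariant show ?thesis by (auto simp: biinvariant_set_def)
qed

end
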